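(* Let $X$ be a Banach lattice with the projection property and let $C$ be an order continuous positive operator on $X$. Then $C$ is nilpotent if and only if there exist a positive central operator $A$ on $X$ and a positive order continuous nilpotent operator $B$ on $X$ such that $C = AB - BA$. Furthermore, if $C$ is compact (and nilpotent), then $B$ can also be chosen to be compact.
   Context: A Banach lattice $X$ has the projection property if every band $B$ in $X$ is a projection band, i.e. $X = B \oplus B^d$. A positive operator $T$ on $X$ is central if there is a positive real number $\lambda$ with $0 \le T \le \lambda I$. An operator $T$ is nilpotent if $T^m = 0$ for some positive integer $m$. A positive operator $T$ is order continuous if $x_\alpha \downarrow 0$ implies $T x_\alpha \downarrow 0$. *)

theory Defs
  imports "HOL-Analysis.Analysis" "HOL-Library.Lattice_Algebras" "HOL-Library.Lub_Glb"
begin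

text \<open>Real Banach lattices; the modulus is \<open>\<bar>x\<bar> = sup x (- x)\<close> by
  \<open>lattice_ab_group_add_abs\<close>.\<close>

class banach_lattice = banach + ordered_real_vector + lattice_ab_group_add_abs +
  assumes norm_mono: "\<bar>x\<bar> \<le> \<bar>y\<bar> \<Longrightarrow> norm x \<le> norm y"

instance real :: banach_lattice
  by standard simp

definition order_ideal :: "'a::banach_lattice set \<Rightarrow> bool" where
  "order_ideal B \<longleftrightarrow> subspace B \<and> (\<forall>y\<in>B. \<forall>x. \<bar>x\<bar> \<le> \<bar>y\<bar> \<longrightarrow> x \<in> B)"

definition band :: "'a::banach_lattice set \<Rightarrow> bool" where
  "band B \<longleftrightarrow> order_ideal B \<and> (\<forall>D x. D \<subseteq> B \<longrightarrow> isLub UNIV D x \<longrightarrow> x \<in> B)"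

definition disjoint_complement :: "'a::banach_lattice set \<Rightarrow> 'a set" where
  "disjoint_complement B = {x. \<forall>b\<in>B. inf \<bar>x\<bar> \<bar>b\<bar> = 0}"

definition projection_band :: "'a::banach_lattice set \<Rightarrow> bool" where
  "projection_band B \<longleftrightarrow> band B \<and> B \<inter> disjoint_complement B = {0} \<and>
    {b + c | b c. b \<in> B \<and> c \<in> disjoint_complement B} = UNIV"

definition projection_property :: "'a::banach_lattice itself \<Rightarrow> bool" where
  "projection_property _ \<longleftrightarrow> (\<forall>B :: 'a set. band B \<longrightarrow> projection_band B)"

text \<open>An operator is a bounded linear map. Boundedness is no restriction, since every positive
  linear map on a Banach lattice is bounded.\<close>

definition positive_operator :: "('a::banach_lattice \<Rightarrow> 'a) \<Rightarrow> bool" where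
  "positive_operator T \<longleftrightarrow> bounded_linear T \<and> (\<forall>x\<ge>0. 0 \<le> T x)"

definition operator_le :: "('a::banach_lattice \<Rightarrow> 'a) \<Rightarrow> ('a \<Rightarrow> 'a) \<Rightarrow> bool" where
  "operator_le S T \<longleftrightarrow> (\<forall>x\<ge>0. S x \<le> T x)"

definition central_operator :: "('a::banach_lattice \<Rightarrow> 'a) \<Rightarrow> bool" where
  "central_operator T \<longleftrightarrow> positive_operator T \<and> (\<exists>c>0. operator_le T (\<lambda>x. c *\<^sub>R x))"

definition nilpotent_operator :: "('a::banach_lattice \<Rightarrow> 'a) \<Rightarrow> bool" where
  "nilpotent_operator T \<longleftrightarrow> (\<exists>m>0. T ^^ m = (\<lambda>_. 0))"

definition compact_operator :: "('a::banach_lattice \<Rightarrow> 'a) \<Rightarrow> bool" where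
  "compact_operator T \<longleftrightarrow> bounded_linear T \<and> compact (closure (T ` cball 0 1))"

text \<open>\<open>net_decreases_to_zero I r x\<close> says that the net \<open>x\<close>, indexed by the set \<open>I\<close> directed by the
  preorder \<open>r\<close>, satisfies \<open>x\<^sub>\<alpha> \<down> 0\<close>.\<close>

definition directed_by :: "'i set \<Rightarrow> 'i rel \<Rightarrow> bool" where
  "directed_by I r \<longleftrightarrow> I \<noteq> {} \<and> preorder_on I r \<and>
    (\<forall>i\<in>I. \<forall>j\<in>I. \<exists>k\<in>I. (i, k) \<in> r \<and> (j, k) \<in> r)"

definition net_decreases_to_zero ::
    "'i set \<Rightarrow> 'i rel \<Rightarrow> ('i \<Rightarrow> 'a::banach_lattice) \<Rightarrow> bool" where
  "net_decreases_to_zero I r x \<longleftrightarrow> directed_by I r \<and>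
    (\<forall>(i, j)\<in>r. x j \<le> x i) \<and> isGlb UNIV (x ` I) 0"

text \<open>A definition cannot quantify over index types, so the index sets here are subsets of the
  space itself. This loses nothing, because a decreasing net may be replaced by its range;
  \<open>order_continuousD\<close> below recovers nets over arbitrary index types.\<close>

definition order_continuous :: "('a::banach_lattice \<Rightarrow> 'a) \<Rightarrow> bool" where
  "order_continuous T \<longleftrightarrow> (\<forall>(I :: 'a set) r x.
    net_decreases_to_zero I r x \<longrightarrow> net_decreases_to_zero I r (\<lambda>i. T (x i)))"

lemma order_continuousD:
  fixes T :: "'a::banach_lattice \<Rightarrow> 'a" and I :: "'i set"
  assumes T: "order_continuous T" and x: "net_decreases_to_zero I r x"
  shows "net_decreases_to_zero I r (\<lambda>i. T (x i))"
proof -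
  define D where "D = x ` I"
  define s where "s = {(a, b). a \<in> D \<and> b \<in> D \<and> b \<le> a}"
  have dir: "directed_by I r" and dec: "\<And>i j. (i, j) \<in> r \<Longrightarrow> x j \<le> x i"
    and glb: "isGlb UNIV D 0"
    using x by (auto simp: net_decreases_to_zero_def D_def)
  have rI: "r \<subseteq> I \<times> I"
    using dir by (auto simp: directed_by_def preorder_on_def)
  have "preorder_on D s"
    by (auto simp: s_def preorder_on_def refl_on_def trans_def)
  moreover have "\<exists>c\<in>D. (a, c) \<in> s \<and> (b, c) \<in> s" if "a \<in> D" "b \<in> D" for a b
  proof -
    obtain i j where "i \<in> I" "j \<in> I" and ab: "a = x i" "b = x j"
      using \<open>a \<in> D\<close> \<open>b \<in> D\<close> by (auto simp: D_def)
    then obtain k where "k \<in> I" "(i, k) \<in> r" "(j, k) \<in> r"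
      using dir by (auto simp: directed_by_def)
    then show ?thesis
      using dec ab that by (auto simp: s_def D_def)
  qed
  ultimately have "directed_by D s"
    using dir by (auto simp: directed_by_def D_def)
  then have "net_decreases_to_zero D s (\<lambda>d. d)"
    using glb by (auto simp: net_decreases_to_zero_def s_def)
  then have "net_decreases_to_zero D s (\<lambda>d. T d)"
    using T by (simp add: order_continuous_def)
  then have mono: "\<And>a b. (a, b) \<in> s \<Longrightarrow> T b \<le> T a" and glbT: "isGlb UNIV (T ` D) 0"
    by (auto simp: net_decreases_to_zero_def)
  have "T (x j) \<le> T (x i)" if "(i, j) \<in> r" for i j
    using that dec rI by (intro mono) (auto simp: s_def D_def)
  then show ?thesis
    using dir glbT by (auto simp: net_decreases_to_zero_def D_def image_image)
qed

end

theory Submission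
  imports Defs
begin

text \<open>
  A nilpotent positive order continuous operator \<open>C\<close> with \<open>C\<^sup>m = 0\<close> is strictly upper triangular
  with respect to a decomposition of the space into bands. The sets \<open>N\<^sub>k = {x. C\<^sup>k \<bar>x\<bar> = 0}\<close> form a
  chain of order ideals \<open>{0} = N\<^sub>0 \<subseteq> N\<^sub>1 \<subseteq> \<dots> \<subseteq> N\<^sub>m = X\<close> with \<open>C N\<^sub>k\<^sub>+\<^sub>1 \<subseteq> N\<^sub>k\<close>, and order continuity makes each
  of them a band (\<open>band_null_ideal\<close>). By the projection property there are band projections \<open>P\<^sub>k\<close>
  onto \<open>N\<^sub>k\<close>. The differences \<open>E\<^sub>i = P\<^sub>i\<^sub>+\<^sub>1 - P\<^sub>i\<close> with \<open>i < m\<close> are positive, mutually orthogonal projections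
  with sum \<open>I\<close>, and the block \<open>E\<^sub>i C E\<^sub>j\<close> vanishes unless \<open>i < j\<close>.

  For a block diagonal operator \<open>A = \<Sum>\<^sub>i a\<^sub>i E\<^sub>i\<close>, passing from \<open>B\<close> to \<open>A B - B A\<close> multiplies the
  block \<open>(i, j)\<close> of \<open>B\<close> by \<open>a\<^sub>i - a\<^sub>j\<close>. The decreasing weights \<open>a\<^sub>i = m - i\<close> make \<open>A\<close> a positive central
  operator and turn this factor into \<open>j - i\<close>, which is at least \<open>1\<close> on the blocks above the diagonal.
  Hence the equation \<open>C = A B - B A\<close> is solved by dividing each block \<open>E\<^sub>i C E\<^sub>j\<close> by \<open>j - i\<close>
  (\<open>strictly_triangular_commutator\<close>). The resulting \<open>B\<close> satisfies \<open>0 \<le> B \<le> C\<close>, so that it inherits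
  nilpotency and order continuity from \<open>C\<close> by domination. Being a finite sum of operators
  \<open>S C T\<close> with \<open>S\<close> and \<open>T\<close> bounded, it also inherits compactness.

  Conversely, if \<open>C = A B - B A\<close> with \<open>0 \<le> A \<le> c I\<close> and \<open>B\<close>, \<open>C\<close> positive, then \<open>C \<le> A B \<le> c B\<close>, so powers of
  \<open>C\<close> are dominated by multiples of powers of \<open>B\<close>, and nilpotency of \<open>B\<close> carries over to \<open>C\<close>.
\<close>

section \<open>Order ideals, disjointness and positive operators\<close>

lemma abs_scaleR_le:
  fixes x :: "'a::banach_lattice"
  shows "\<bar>c *\<^sub>R x\<bar> \<le> \<bar>c\<bar> *\<^sub>R \<bar>x\<bar>"
proof -
  have nonneg: "\<bar>d *\<^sub>R y\<bar> \<le> d *\<^sub>R \<bar>y\<bar>" if "0 \<le> d" for d :: real and y :: 'a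
  proof (rule abs_leI)
    show "d *\<^sub>R y \<le> d *\<^sub>R \<bar>y\<bar>"
      using that by (intro scaleR_left_mono abs_ge_self)
    have "d *\<^sub>R (- y) \<le> d *\<^sub>R \<bar>y\<bar>"
      using that by (intro scaleR_left_mono abs_ge_minus_self)
    then show "- (d *\<^sub>R y) \<le> d *\<^sub>R \<bar>y\<bar>"
      by simp
  qed
  show ?thesis
  proof (cases "0 \<le> c")
    case True
    then show ?thesis
      using nonneg[of c x] by simp
  next
    case False
    then show ?thesis
      using nonneg[of "- c" x] by simp
  qed
qed

text \<open>
  Subadditivity of \<open>\<lambda>x. inf x z\<close> on the positive cone. It is what makes elements disjoint from
  a given one closed under addition.
\<close>

lemma inf_add_le:
  fixes x y z :: "'a::banach_lattice"
  assumes "0 \<le> x" "0 \<le> y" "0 \<le> z"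
  shows "inf (x + y) z \<le> inf x z + inf y z"
proof -
  have "inf (x + y) z \<le> x + z" "inf (x + y) z \<le> z + y" "inf (x + y) z \<le> z + z"
    using assms by (auto intro: le_infI2 simp: add_increasing add_increasing2)
  then show ?thesis
    by (simp add: add_inf_distrib_left add_inf_distrib_right)
qed

lemma order_ideal_disjoint_complement:
  fixes S :: "'a::banach_lattice set"
  shows "order_ideal (disjoint_complement S)"
proof -
  have solid: "x \<in> disjoint_complement S" if "y \<in> disjoint_complement S" "\<bar>x\<bar> \<le> \<bar>y\<bar>" for x y
    unfolding disjoint_complement_def
  proof (intro CollectI ballI antisym)
    fix b assume "b \<in> S"
    then have "inf \<bar>y\<bar> \<bar>b\<bar> = 0"
      using that by (auto simp: disjoint_complement_def)
    then show "inf \<bar>x\<bar> \<bar>b\<bar> \<le> 0"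
      using inf_mono[OF \<open>\<bar>x\<bar> \<le> \<bar>y\<bar>\<close> order_refl[of "\<bar>b\<bar>"]] by simp
  qed simp
  have "subspace (disjoint_complement S)"
  proof (rule subspaceI)
    show "0 \<in> disjoint_complement S"
      by (auto simp: disjoint_complement_def inf_absorb1)
  next
    fix x y assume xy: "x \<in> disjoint_complement S" "y \<in> disjoint_complement S"
    show "x + y \<in> disjoint_complement S"
      unfolding disjoint_complement_def
    proof (intro CollectI ballI antisym)
      fix b assume "b \<in> S"
      have "inf \<bar>x + y\<bar> \<bar>b\<bar> \<le> inf (\<bar>x\<bar> + \<bar>y\<bar>) \<bar>b\<bar>"
        by (intro inf_mono abs_triangle_ineq order_refl)
      also have "\<dots> \<le> inf \<bar>x\<bar> \<bar>b\<bar> + inf \<bar>y\<bar> \<bar>b\<bar>"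
        by (intro inf_add_le) auto
      also have "\<dots> = 0"
        using xy \<open>b \<in> S\<close> by (auto simp: disjoint_complement_def)
      finally show "inf \<bar>x + y\<bar> \<bar>b\<bar> \<le> 0" .
    qed simp
  next
    fix c x assume x: "x \<in> disjoint_complement S"
    show "c *\<^sub>R x \<in> disjoint_complement S"
      unfolding disjoint_complement_def
    proof (intro CollectI ballI antisym)
      fix b assume "b \<in> S"
      (* A factor t that is at least both 1 and |c|: then y / t lies below both |x| and |b|. *)
      define t where "t = max 1 \<bar>c\<bar>"
      have t: "0 < t" "1 \<le> t" "\<bar>c\<bar> \<le> t"
        by (auto simp: t_def)
      let ?y = "inf \<bar>c *\<^sub>R x\<bar> \<bar>b\<bar>"
      have "?y \<le> \<bar>c\<bar> *\<^sub>R \<bar>x\<bar>"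
        using abs_scaleR_le by (rule le_infI1)
      also have "\<dots> \<le> t *\<^sub>R \<bar>x\<bar>"
        using t by (intro scaleR_right_mono) auto
      finally have 1: "inverse t *\<^sub>R ?y \<le> \<bar>x\<bar>"
        using t by (simp only: pos_divideR_le_eq)
      have "?y \<le> 1 *\<^sub>R \<bar>b\<bar>"
        by simp
      also have "\<dots> \<le> t *\<^sub>R \<bar>b\<bar>"
        using t by (intro scaleR_right_mono) auto
      finally have "inverse t *\<^sub>R ?y \<le> \<bar>b\<bar>"
        using t by (simp only: pos_divideR_le_eq)
      with 1 have "inverse t *\<^sub>R ?y \<le> inf \<bar>x\<bar> \<bar>b\<bar>"
        by (rule le_infI)
      also have "\<dots> = 0"
        using x \<open>b \<in> S\<close> by (auto simp: disjoint_complement_def)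
      finally have "?y \<le> t *\<^sub>R 0"
        using t by (simp only: pos_divideR_le_eq)
      then show "?y \<le> 0"
        by simp
    qed simp
  qed
  with solid show ?thesis
    by (auto simp: order_ideal_def)
qed

lemma positive_operator_mono:
  assumes "positive_operator T" "x \<le> y"
  shows "T x \<le> T y"
proof -
  have "0 \<le> T (y - x)"
    using assms by (auto simp: positive_operator_def)
  also have "T (y - x) = T y - T x"
    using assms by (auto simp: positive_operator_def bounded_linear.linear linear_diff)
  finally show ?thesis
    by simp
qed

lemma linear_positive_abs_le:
  fixes T :: "'a::banach_lattice \<Rightarrow> 'a"
  assumes lin: "linear T" and pos: "\<And>x. 0 \<le> x \<Longrightarrow> 0 \<le> T x"
  shows "\<bar>T x\<bar> \<le> T \<bar>x\<bar>"
proof (rule abs_leI)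
  have "0 \<le> T (\<bar>x\<bar> - x)"
    by (intro pos) (simp add: abs_ge_self)
  then show "T x \<le> T \<bar>x\<bar>"
    by (simp add: linear_diff[OF lin])
  have "0 \<le> T (\<bar>x\<bar> - (- x))"
    using abs_ge_minus_self[of x] by (intro pos) (simp only: diff_ge_0_iff_ge)
  then have "0 \<le> T \<bar>x\<bar> - T (- x)"
    by (simp only: linear_diff[OF lin])
  then show "- T x \<le> T \<bar>x\<bar>"
    by (simp only: linear_neg[OF lin] diff_ge_0_iff_ge)
qed

lemma positive_operator_abs_le:
  assumes "positive_operator T"
  shows "\<bar>T x\<bar> \<le> T \<bar>x\<bar>"
  using assms
  by (intro linear_positive_abs_le[of T]) (auto simp: positive_operator_def bounded_linear.linear)

text \<open>
  The positive cone spans the space, since \<open>x = pprt x - (- nprt x)\<close>.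
\<close>

lemma linear_eq_on_positive:
  fixes S T :: "'a::banach_lattice \<Rightarrow> 'a"
  assumes "linear S" "linear T" "\<And>x. 0 \<le> x \<Longrightarrow> S x = T x"
  shows "S = T"
proof
  fix x
  have "S x = S (pprt x) - S (- nprt x)"
    using prts[of x] assms(1) by (simp flip: linear_diff)
  also have "\<dots> = T (pprt x) - T (- nprt x)"
    using assms(3) by simp
  also have "\<dots> = T x"
    using prts[of x] assms(2) by (simp flip: linear_diff)
  finally show "S x = T x" .
qed

lemma positive_operator_funpow:
  assumes "positive_operator T"
  shows "positive_operator (T ^^ n)"
proof (induction n)
  case 0
  show ?case
    by (simp add: positive_operator_def id_def bounded_linear_ident)
next
  case (Suc n)
  then show ?case
    using assms by (auto simp: positive_operator_def bounded_linear_compose o_def)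
qed

text \<open>
  Domination passes to powers, \<open>S\<^sup>n \<le> c\<^sup>n T\<^sup>n\<close> on the positive cone, because both operators are monotone.
\<close>

lemma nilpotent_operator_dominated:
  assumes S: "positive_operator S" and T: "positive_operator T" and "0 \<le> c"
    and le: "operator_le S (\<lambda>x. c *\<^sub>R T x)" and nil: "nilpotent_operator T"
  shows "nilpotent_operator S"
proof -
  obtain m where m: "0 < m" "T ^^ m = (\<lambda>_. 0)"
    using nil by (auto simp: nilpotent_operator_def)
  have Sn: "positive_operator (S ^^ n)" and Tn: "positive_operator (T ^^ n)" for n
    by (intro positive_operator_funpow S T)+
  have pow: "(S ^^ n) x \<le> c ^ n *\<^sub>R (T ^^ n) x" if "0 \<le> x" for n x
  proof (induction n)
    case (Suc n)
    have "S ((S ^^ n) x) \<le> c *\<^sub>R T ((S ^^ n) x)"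
      using le Sn[of n] \<open>0 \<le> x\<close> by (simp add: operator_le_def positive_operator_def)
    also have "\<dots> \<le> c *\<^sub>R T (c ^ n *\<^sub>R (T ^^ n) x)"
      using \<open>0 \<le> c\<close> by (intro scaleR_left_mono positive_operator_mono[OF T] Suc)
    also have "\<dots> = c ^ Suc n *\<^sub>R (T ^^ Suc n) x"
      using T by (simp add: positive_operator_def bounded_linear.linear linear_scale)
    finally show ?case
      by simp
  qed simp
  have "S ^^ m = (\<lambda>_. 0)"
  proof (rule linear_eq_on_positive)
    show "linear (S ^^ m)"
      using Sn by (auto simp: positive_operator_def bounded_linear.linear)
    fix x :: 'a assume x: "0 \<le> x"
    show "(S ^^ m) x = 0"
      using pow[OF x, of m] Sn[of m] x m by (auto simp: positive_operator_def intro: antisym)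
  qed (auto intro: bounded_linear.linear)
  with m show ?thesis
    by (auto simp: nilpotent_operator_def)
qed

text \<open>
  The images \<open>S x\<^sub>\<alpha>\<close> are squeezed between \<open>0\<close> and \<open>T x\<^sub>\<alpha>\<close>, whose infimum is \<open>0\<close>.
\<close>

lemma order_continuous_dominated:
  fixes S T :: "'a::banach_lattice \<Rightarrow> 'a"
  assumes S: "positive_operator S" and le: "operator_le S T" and T: "order_continuous T"
  shows "order_continuous S"
  unfolding order_continuous_def
proof (intro allI impI)
  fix I :: "'a set" and r and x :: "'a \<Rightarrow> 'a"
  assume x: "net_decreases_to_zero I r x"
  have pos: "0 \<le> x i" if "i \<in> I" for i
    using x that by (auto simp: net_decreases_to_zero_def dest!: isGlbD1 setgeD)
  have Tx: "isGlb UNIV ((\<lambda>i. T (x i)) ` I) 0"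
    using T x by (auto simp: order_continuous_def net_decreases_to_zero_def)
  have "isGlb UNIV ((\<lambda>i. S (x i)) ` I) 0"
    unfolding isGlb_def greatestP_def isLb_def
  proof (intro conjI setgeI setleI ballI UNIV_I)
    fix y assume "y \<in> (\<lambda>i. S (x i)) ` I"
    then show "0 \<le> y"
      using S pos by (auto simp: positive_operator_def)
  next
    fix y assume "y \<in> {z. z <=* (\<lambda>i. S (x i)) ` I \<and> z \<in> UNIV}"
    then have "y \<le> S (x i)" if "i \<in> I" for i
      using that by (auto simp: setge_def)
    then have "y \<le> T (x i)" if "i \<in> I" for i
      using that le pos by (meson operator_le_def order_trans)
    then show "y \<le> 0"
      using Tx by (auto simp: isGlb_def greatestP_def isLb_def setge_def setle_def)
  qed
  then show "net_decreases_to_zero I r (\<lambda>i. S (x i))"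
    using x positive_operator_mono[OF S] by (auto simp: net_decreases_to_zero_def)
qed

lemma order_continuous_funpow:
  assumes "order_continuous T"
  shows "order_continuous (T ^^ n)"
proof (induction n)
  case (Suc n)
  then show ?case
    using assms by (simp add: order_continuous_def)
qed (simp add: order_continuous_def)

section \<open>Null ideals of order continuous operators are bands\<close>

text \<open>
  For a positive operator this is the largest order ideal contained in the kernel.
\<close>

definition null_ideal :: "('a::banach_lattice \<Rightarrow> 'a) \<Rightarrow> 'a set" where
  "null_ideal T = {x. T \<bar>x\<bar> = 0}"

lemma null_ideal_solid:
  assumes T: "positive_operator T" and y: "y \<in> null_ideal T" and "\<bar>x\<bar> \<le> \<bar>y\<bar>"
  shows "x \<in> null_ideal T"
proof -
  have "T \<bar>x\<bar> \<le> T \<bar>y\<bar>"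
    using \<open>\<bar>x\<bar> \<le> \<bar>y\<bar>\<close> by (rule positive_operator_mono[OF T])
  moreover have "0 \<le> T \<bar>x\<bar>"
    using T by (simp add: positive_operator_def)
  ultimately show ?thesis
    using y by (simp add: null_ideal_def)
qed

lemma null_ideal_image_eq_0:
  assumes "positive_operator T" "x \<in> null_ideal T"
  shows "T x = 0"
  using positive_operator_abs_le[OF assms(1), of x] assms(2) by (simp add: null_ideal_def)

lemma order_ideal_null_ideal:
  assumes T: "positive_operator T"
  shows "order_ideal (null_ideal T)"
  unfolding order_ideal_def
proof (intro conjI ballI allI impI subspaceI)
  have lin: "linear T"
    using T by (simp add: positive_operator_def bounded_linear.linear)
  show "0 \<in> null_ideal T"
    using lin by (simp add: null_ideal_def linear_0)
  show "x + y \<in> null_ideal T" if "x \<in> null_ideal T" "y \<in> null_ideal T" for x y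
  proof (rule null_ideal_solid[OF T])
    show "\<bar>x\<bar> + \<bar>y\<bar> \<in> null_ideal T"
      using that lin by (simp add: null_ideal_def linear_add)
  qed (simp add: abs_triangle_ineq)
  show "c *\<^sub>R x \<in> null_ideal T" if "x \<in> null_ideal T" for c x
  proof (rule null_ideal_solid[OF T])
    show "\<bar>c\<bar> *\<^sub>R \<bar>x\<bar> \<in> null_ideal T"
      using that lin by (simp add: null_ideal_def linear_scale abs_of_nonneg scaleR_nonneg_nonneg)
    show "\<bar>c *\<^sub>R x\<bar> \<le> \<bar>\<bar>c\<bar> *\<^sub>R \<bar>x\<bar>\<bar>"
      using abs_scaleR_le[of c x] by (simp add: abs_of_nonneg scaleR_nonneg_nonneg)
  qed
  show "x \<in> null_ideal T" if "y \<in> null_ideal T" "\<bar>x\<bar> \<le> \<bar>y\<bar>" for x y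
    using null_ideal_solid[OF T that] .
qed

text \<open>
  Let \<open>x\<close> be the supremum of a set \<open>D\<close> of elements of the null ideal. The elements \<open>d\<close> of the ideal
  below \<open>x\<close> are directed upwards, and \<open>x - d\<close> decreases to \<open>0\<close> along them. Since \<open>T d = 0\<close>, the net
  \<open>T (x - d)\<close> is constantly \<open>T x\<close>, and order continuity forces \<open>T x = 0\<close>. As \<open>x\<close> may fail to be
  positive, the passage to the modulus goes through the positive element \<open>x - d\<close> for some \<open>d \<in> D\<close>.
\<close>

lemma band_null_ideal:
  assumes T: "positive_operator T" and oc: "order_continuous T"
  shows "band (null_ideal T)"
  unfolding band_def
proof (intro conjI allI impI)
  show ideal: "order_ideal (null_ideal T)"
    by (rule order_ideal_null_ideal[OF T])
  then have sub: "subspace (null_ideal T)"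
    by (simp add: order_ideal_def)
  fix D x assume D: "D \<subseteq> null_ideal T" and x: "isLub UNIV D x"
  show "x \<in> null_ideal T"
  proof (cases "D = {}")
    case True
    (* A supremum of the empty set is a least element, which forces the space to be trivial. *)
    then have le: "x \<le> y" for y
      using x by (auto simp: isLub_def leastP_def isUb_def setle_def setge_def)
    have "x \<le> x + x"
      by (rule le)
    with le[of 0] have "x = 0"
      by (auto intro: antisym)
    then show ?thesis
      using sub by (simp add: subspace_0)
  next
    case False
    then obtain d0 where d0: "d0 \<in> D"
      by auto
    (* Enlarging D to I makes it directed without computing finite suprema of elements of D. *)
    define I where "I = {d \<in> null_ideal T. d \<le> x}"
    define r where "r = {(i, j). i \<in> I \<and> j \<in> I \<and> i \<le> j}"
    have DI: "D \<subseteq> I"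
      using D isLubD2[OF x] by (auto simp: I_def)
    have supI: "sup i j \<in> I" if "i \<in> I" "j \<in> I" for i j
    proof -
      have "\<bar>sup i j\<bar> \<le> \<bar>i\<bar> + \<bar>j\<bar>"
      proof (rule abs_leI)
        show "sup i j \<le> \<bar>i\<bar> + \<bar>j\<bar>"
          by (intro le_supI add_increasing[of "\<bar>i\<bar>" j] add_increasing2[of "\<bar>j\<bar>" i]
              abs_ge_self abs_ge_zero)
        have "- sup i j \<le> - i"
          by (simp del: neg_sup_eq_inf)
        also have "\<dots> \<le> \<bar>i\<bar> + \<bar>j\<bar>"
          by (intro add_increasing2 abs_ge_minus_self) auto
        finally show "- sup i j \<le> \<bar>i\<bar> + \<bar>j\<bar>" .
      qed
      moreover have "\<bar>i\<bar> + \<bar>j\<bar> \<in> null_ideal T"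
        using that ideal sub by (intro subspace_add) (auto simp: I_def null_ideal_def)
      ultimately have "sup i j \<in> null_ideal T"
        using null_ideal_solid[OF T, of "\<bar>i\<bar> + \<bar>j\<bar>" "sup i j"]
        by (simp add: abs_of_nonneg)
      with that show ?thesis
        by (auto simp: I_def)
    qed
    have dir: "directed_by I r"
      unfolding directed_by_def
    proof (intro conjI ballI)
      show "I \<noteq> {}"
        using d0 DI by auto
      show "preorder_on I r"
        by (auto simp: r_def preorder_on_def refl_on_def trans_def)
      show "\<exists>k\<in>I. (i, k) \<in> r \<and> (j, k) \<in> r" if "i \<in> I" "j \<in> I" for i j
        using that supI[OF that] by (intro bexI[of _ "sup i j"]) (auto simp: r_def)
    qed
    have "isGlb UNIV ((\<lambda>i. x - i) ` I) 0"
      unfolding isGlb_def greatestP_def isLb_def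
    proof (intro conjI setgeI setleI ballI UNIV_I)
      fix y assume "y \<in> (\<lambda>i. x - i) ` I"
      then show "0 \<le> y"
        by (auto simp: I_def)
    next
      fix y assume "y \<in> {z. z <=* (\<lambda>i. x - i) ` I \<and> z \<in> UNIV}"
      then have "y \<le> x - d" if "d \<in> D" for d
        using that DI by (auto simp: setge_def)
      then have "isUb UNIV D (x - y)"
        by (intro isUb_UNIV_I) (simp add: algebra_simps)
      then have "x \<le> x - y"
        by (rule isLub_le_isUb[OF x])
      then show "y \<le> 0"
        by simp
    qed
    with dir have "net_decreases_to_zero I r (\<lambda>i. x - i)"
      by (auto simp: net_decreases_to_zero_def r_def)
    then have "net_decreases_to_zero I r (\<lambda>i. T (x - i))"
      using oc by (simp add: order_continuous_def)
    then have glb: "isGlb UNIV ((\<lambda>i. T (x - i)) ` I) 0"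
      by (simp add: net_decreases_to_zero_def)
    have Td: "T (x - i) = T x" if "i \<in> I" for i
      using T that null_ideal_image_eq_0[OF T, of i]
      by (auto simp: positive_operator_def bounded_linear.linear linear_diff I_def)
    have "0 \<le> T x" "T x \<le> 0"
      using glb Td d0 DI
      by (auto simp: isGlb_def greatestP_def isLb_def setge_def setle_def)
    then have "x - d0 \<in> null_ideal T"
      using d0 DI Td[of d0] by (auto simp: null_ideal_def I_def abs_of_nonneg)
    then have "(x - d0) + d0 \<in> null_ideal T"
      using sub d0 D by (intro subspace_add) auto
    then show ?thesis
      by simp
  qed
qed

section \<open>Band projections\<close>

text \<open>
  The component of \<open>x\<close> in \<open>B\<close>. The description is proper exactly when \<open>x\<close> has a unique
  decomposition along \<open>B\<close> and its disjoint complement, as for every \<open>x\<close> when \<open>B\<close> is a projection band.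
\<close>

definition band_projection :: "'a::banach_lattice set \<Rightarrow> 'a \<Rightarrow> 'a" where
  "band_projection B x = (THE b. b \<in> B \<and> x - b \<in> disjoint_complement B)"

lemma projection_bandD:
  assumes "projection_band B"
  shows "subspace B" "subspace (disjoint_complement B)"
  using assms order_ideal_disjoint_complement[of B]
  by (auto simp: projection_band_def band_def order_ideal_def)

lemma band_projection_unique:
  assumes B: "projection_band B" and b: "b \<in> B" "x - b \<in> disjoint_complement B"
  shows "band_projection B x = b"
  unfolding band_projection_def
proof (rule the_equality)
  fix b' assume b': "b' \<in> B \<and> x - b' \<in> disjoint_complement B"
  have "b' - b \<in> B"
    using b b' by (auto intro: subspace_diff[OF projection_bandD(1)[OF B]])
  moreover have "(x - b) - (x - b') \<in> disjoint_complement B"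
    using b b' by (intro subspace_diff[OF projection_bandD(2)[OF B], of "x - b" "x - b'"]) auto
  ultimately have "b' - b \<in> B \<inter> disjoint_complement B"
    by simp
  also have "B \<inter> disjoint_complement B = {0}"
    using B by (simp add: projection_band_def)
  finally show "b' = b"
    by simp
qed (use b in auto)

lemma band_projection_mem:
  assumes B: "projection_band B"
  shows "band_projection B x \<in> B" "x - band_projection B x \<in> disjoint_complement B"
proof -
  have "x \<in> {b + c | b c. b \<in> B \<and> c \<in> disjoint_complement B}"
    using B by (simp add: projection_band_def)
  then obtain b c where "x = b + c" "b \<in> B" "c \<in> disjoint_complement B"
    by auto
  then have "b \<in> B" "x - b \<in> disjoint_complement B"
    by auto
  with band_projection_unique[OF B this]
  show "band_projection B x \<in> B" "x - band_projection B x \<in> disjoint_complement B"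
    by auto
qed

lemma linear_band_projection:
  assumes B: "projection_band B"
  shows "linear (band_projection B)"
proof (rule linearI)
  note mem = band_projection_mem[OF B] and sub = projection_bandD[OF B]
  let ?P = "band_projection B"
  fix x y :: 'a and c :: real
  have "(x - ?P x) + (y - ?P y) \<in> disjoint_complement B"
    by (intro subspace_add sub mem)
  then show "?P (x + y) = ?P x + ?P y"
    by (intro band_projection_unique B subspace_add sub mem) (simp add: algebra_simps)
  have "c *\<^sub>R (x - ?P x) \<in> disjoint_complement B"
    by (intro subspace_scale sub mem)
  then show "?P (c *\<^sub>R x) = c *\<^sub>R ?P x"
    by (intro band_projection_unique B subspace_scale sub mem) (simp add: algebra_simps)
qed

text \<open>
  Write \<open>x = b + c\<close> with \<open>b\<close> and \<open>c\<close> disjoint. From \<open>x \<ge> 0\<close> follows \<open>- b \<le> c\<close>, so \<open>- b\<close> lies below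
  both \<open>\<bar>b\<bar>\<close> and \<open>\<bar>c\<bar>\<close>, hence below their infimum \<open>0\<close>. The same holds for \<open>- c\<close>.
\<close>

lemma band_projection_bounds:
  assumes B: "projection_band B" and x: "0 \<le> x"
  shows "0 \<le> band_projection B x" "band_projection B x \<le> x"
proof -
  define b where "b = band_projection B x"
  define c where "c = x - b"
  have "inf \<bar>c\<bar> \<bar>b\<bar> = 0"
    using band_projection_mem[OF B, of x] by (auto simp: b_def c_def disjoint_complement_def)
  moreover have "- b \<le> \<bar>c\<bar>"
  proof (rule order_trans[OF _ abs_ge_self])
    show "- b \<le> c"
      using x by (simp add: c_def)
  qed
  moreover have "- c \<le> \<bar>b\<bar>"
  proof (rule order_trans[OF _ abs_ge_self])
    show "- c \<le> b"
      using x by (simp add: c_def)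
  qed
  ultimately have "- b \<le> 0" "- c \<le> 0"
    using le_infI[of "- b" "\<bar>c\<bar>" "\<bar>b\<bar>"] le_infI[of "- c" "\<bar>c\<bar>" "\<bar>b\<bar>"]
      abs_ge_minus_self[of b] abs_ge_minus_self[of c]
    by (simp_all only:)
  then show "0 \<le> band_projection B x" "band_projection B x \<le> x"
    by (auto simp: b_def c_def)
qed

text \<open>
  Boundedness comes from \<open>\<bar>P x\<bar> \<le> P \<bar>x\<bar> \<le> \<bar>x\<bar>\<close> and the monotonicity of the norm.
\<close>

lemma positive_operator_band_projection:
  assumes B: "projection_band B"
  shows "positive_operator (band_projection B)"
proof -
  let ?P = "band_projection B"
  note lin = linear_band_projection[OF B] and bounds = band_projection_bounds[OF B]
  have "norm (?P x) \<le> norm x * 1" for x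
  proof -
    have "\<bar>?P x\<bar> \<le> ?P \<bar>x\<bar>"
      by (rule linear_positive_abs_le[OF lin bounds(1)])
    also have "\<dots> \<le> \<bar>x\<bar>"
      by (intro bounds abs_ge_zero)
    finally show ?thesis
      using norm_mono by simp
  qed
  then have "bounded_linear ?P"
    using lin unfolding bounded_linear_def bounded_linear_axioms_def by blast
  with bounds(1) show ?thesis
    by (simp add: positive_operator_def)
qed

lemma disjoint_complement_antimono: "S \<subseteq> T \<Longrightarrow> disjoint_complement T \<subseteq> disjoint_complement S"
  by (auto simp: disjoint_complement_def)

lemma band_projection_id:
  assumes "projection_band B" "x \<in> B"
  shows "band_projection B x = x"
  using assms projection_bandD[OF assms(1)]
  by (intro band_projection_unique) (auto simp: subspace_0)

lemma band_projection_disjoint: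
  assumes "projection_band B" "x \<in> disjoint_complement B"
  shows "band_projection B x = 0"
  using assms projection_bandD[OF assms(1)]
  by (intro band_projection_unique) (auto simp: subspace_0)

text \<open>
  The remainder of the projection to the larger band is disjoint from it, hence also from the
  smaller band, which therefore does not see it.
\<close>

lemma band_projection_subset:
  assumes B: "projection_band B" and B': "projection_band B'" and "B \<subseteq> B'"
  shows "band_projection B (band_projection B' x) = band_projection B x"
proof -
  have "band_projection B (x - band_projection B' x) = 0"
    using band_projection_mem(2)[OF B', of x] disjoint_complement_antimono[OF \<open>B \<subseteq> B'\<close>]
    by (intro band_projection_disjoint[OF B]) auto
  then show ?thesis
    using linear_diff[OF linear_band_projection[OF B]] by simp
qed

section \<open>Compact operators\<close>

text \<open>
  Replaces the closure in the definition of compactness by an arbitrary compact superset.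
\<close>

lemma compact_operatorI:
  assumes "bounded_linear T" "compact K" "T ` cball 0 1 \<subseteq> K"
  shows "compact_operator T"
proof -
  have "closure (T ` cball 0 1) \<subseteq> K"
    using assms by (simp add: closure_minimal compact_imp_closed)
  then have "compact (K \<inter> closure (T ` cball 0 1))"
    using assms by (intro compact_Int_closed) auto
  with \<open>closure (T ` cball 0 1) \<subseteq> K\<close> show ?thesis
    using assms by (simp add: compact_operator_def Int_absorb1)
qed

lemma compact_operator_0: "compact_operator (\<lambda>_. 0)"
  by (rule compact_operatorI[of _ "{0}"]) (auto intro: bounded_linear_zero)

lemma compact_operator_add:
  assumes S: "compact_operator S" and T: "compact_operator T"
  shows "compact_operator (\<lambda>x. S x + T x)"
proof (rule compact_operatorI)
  let ?K = "\<lambda>T. closure (T ` cball 0 1)"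
  show "compact {x + y | x y. x \<in> ?K S \<and> y \<in> ?K T}"
    using S T by (intro compact_sums) (auto simp: compact_operator_def)
  show "(\<lambda>x. S x + T x) ` cball 0 1 \<subseteq> {x + y | x y. x \<in> ?K S \<and> y \<in> ?K T}"
    using closure_subset[of "S ` cball 0 1"] closure_subset[of "T ` cball 0 1"] by blast
  show "bounded_linear (\<lambda>x. S x + T x)"
    using S T by (auto simp: compact_operator_def bounded_linear_add)
qed

lemma compact_operator_sum:
  assumes "\<And>i. i \<in> I \<Longrightarrow> compact_operator (T i)"
  shows "compact_operator (\<lambda>x. \<Sum>i\<in>I. T i x)"
  using assms
proof (induction I rule: infinite_finite_induct)
  case (insert i I)
  then show ?case
    by (simp add: compact_operator_add)
qed (simp_all add: compact_operator_0)

lemma compact_operator_compose_left: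
  assumes S: "bounded_linear S" and T: "compact_operator T"
  shows "compact_operator (\<lambda>x. S (T x))"
proof (rule compact_operatorI)
  show "compact (S ` closure (T ` cball 0 1))"
    using T S by (intro compact_continuous_image linear_continuous_on)
      (auto simp: compact_operator_def)
  show "(\<lambda>x. S (T x)) ` cball 0 1 \<subseteq> S ` closure (T ` cball 0 1)"
    using closure_subset[of "T ` cball 0 1"] by blast
  show "bounded_linear (\<lambda>x. S (T x))"
    using T S by (auto simp: compact_operator_def intro: bounded_linear_compose)
qed

lemma compact_operator_compose_right:
  assumes S: "bounded_linear S" and T: "compact_operator T"
  shows "compact_operator (\<lambda>x. T (S x))"
proof -
  have blT: "bounded_linear T"
    using T by (simp add: compact_operator_def)
  obtain K where K: "0 < K" "\<And>x. norm (S x) \<le> norm x * K"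
    using bounded_linear.pos_bounded[OF S] by auto
  show ?thesis
  proof (rule compact_operatorI)
    show "compact ((\<lambda>x. K *\<^sub>R x) ` closure (T ` cball 0 1))"
      using T by (intro compact_scaling) (auto simp: compact_operator_def)
    show "(\<lambda>x. T (S x)) ` cball 0 1 \<subseteq> (\<lambda>x. K *\<^sub>R x) ` closure (T ` cball 0 1)"
    proof (rule image_subsetI)
      fix x :: 'a assume "x \<in> cball 0 1"
      then have "norm x * K \<le> 1 * K"
        using K(1) by (intro mult_right_mono) auto
      then have "norm (S x) \<le> K"
        using K(2)[of x] by simp
      then have "inverse K *\<^sub>R S x \<in> cball 0 1"
        using K(1) by (simp add: field_simps)
      then have "T (inverse K *\<^sub>R S x) \<in> closure (T ` cball 0 1)"
        by (intro subsetD[OF closure_subset] imageI)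
      moreover have "T (S x) = K *\<^sub>R T (inverse K *\<^sub>R S x)"
        using K(1) blT by (simp add: bounded_linear.linear linear_scale)
      ultimately show "T (S x) \<in> (\<lambda>x. K *\<^sub>R x) ` closure (T ` cball 0 1)"
        by blast
    qed
    show "bounded_linear (\<lambda>x. T (S x))"
      using blT S by (auto intro: bounded_linear_compose)
  qed
qed

section \<open>Strictly triangular operators are commutators\<close>

text \<open>
  The block \<open>(i, j)\<close> of \<open>A B - B A\<close> is \<open>(m - i) - (m - j) = j - i\<close> times that of \<open>B\<close>, and \<open>w i j\<close> is the
  reciprocal of this factor above the diagonal. On and below the diagonal the blocks of \<open>C\<close> are
  zero already, in agreement with \<open>w i j = 0\<close>.
\<close>

lemma strictly_triangular_commutator:
  fixes C :: "'a::real_vector \<Rightarrow> 'a" and E :: "nat \<Rightarrow> 'a \<Rightarrow> 'a" and m :: nat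
  defines "w \<equiv> \<lambda>i j. if i < j then 1 / (real j - real i) else 0"
  defines "A \<equiv> \<lambda>x. \<Sum>i<m. (real m - real i) *\<^sub>R E i x"
  defines "B \<equiv> \<lambda>x. \<Sum>i<m. \<Sum>j<m. w i j *\<^sub>R E i (C (E j x))"
  assumes C: "linear C" and E: "\<And>i. linear (E i)"
    and orth: "\<And>i j x. i < m \<Longrightarrow> j < m \<Longrightarrow> E i (E j x) = (if i = j then E i x else 0)"
    and total: "\<And>x. (\<Sum>i<m. E i x) = x"
    and upper: "\<And>i j x. j \<le> i \<Longrightarrow> i < m \<Longrightarrow> E i (C (E j x)) = 0"
  shows "A (B x) - B (A x) = C x"
proof -
  have A_lin: "linear A"
    unfolding A_def by (intro linear_compose_sum ballI linear_compose_scale_right E)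
  have AE: "A (E i y) = (real m - real i) *\<^sub>R E i y" if "i < m" for i y
  proof -
    have "A (E i y) = (\<Sum>k<m. if k = i then (real m - real i) *\<^sub>R E i y else 0)"
      unfolding A_def using that by (intro sum.cong) (auto simp: orth)
    then show ?thesis
      using that by simp
  qed
  have EA: "E j (A y) = (real m - real j) *\<^sub>R E j y" if "j < m" for j y
  proof -
    have "E j (A y) = (\<Sum>k<m. (real m - real k) *\<^sub>R E j (E k y))"
      unfolding A_def by (simp add: linear_sum[OF E] linear_scale[OF E])
    also have "\<dots> = (\<Sum>k<m. if k = j then (real m - real j) *\<^sub>R E j y else 0)"
      using that by (intro sum.cong) (auto simp: orth)
    finally show ?thesis
      using that by simp
  qed
  have "A (B x) = (\<Sum>i<m. \<Sum>j<m. w i j *\<^sub>R A (E i (C (E j x))))"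
    unfolding B_def by (simp add: linear_sum[OF A_lin] linear_scale[OF A_lin])
  also have "\<dots> = (\<Sum>i<m. \<Sum>j<m. (w i j * (real m - real i)) *\<^sub>R E i (C (E j x)))"
    by (simp add: AE)
  finally have AB: "A (B x) = \<dots>" .
  have BA: "B (A x) = (\<Sum>i<m. \<Sum>j<m. (w i j * (real m - real j)) *\<^sub>R E i (C (E j x)))"
    unfolding B_def by (simp add: EA linear_scale[OF E] linear_scale[OF C])
  have "A (B x) - B (A x) = (\<Sum>i<m. \<Sum>j<m. (w i j * (real j - real i)) *\<^sub>R E i (C (E j x)))"
    unfolding AB BA by (simp add: algebra_simps flip: sum_subtractf scaleR_diff_left)
  also have "\<dots> = (\<Sum>i<m. \<Sum>j<m. E i (C (E j x)))"
    by (intro sum.cong refl) (auto simp: w_def upper)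
  also have "\<dots> = (\<Sum>i<m. E i (C (\<Sum>j<m. E j x)))"
    by (simp add: linear_sum[OF E] linear_sum[OF C])
  also have "\<dots> = C x"
    by (simp add: total)
  finally show ?thesis .
qed

section \<open>Nilpotent operators as commutators\<close>

text \<open>
  Dropping the positive term \<open>B A\<close> leaves \<open>C \<le> A B \<le> c B\<close>.
\<close>

lemma nilpotent_operator_commutatorD:
  fixes C :: "'a::banach_lattice \<Rightarrow> 'a"
  assumes C: "positive_operator C" and A: "central_operator A"
    and B: "positive_operator B" "nilpotent_operator B"
    and eq: "C = (\<lambda>x. A (B x) - B (A x))"
  shows "nilpotent_operator C"
proof -
  obtain c where c: "c > 0" "operator_le A (\<lambda>x. c *\<^sub>R x)" and posA: "positive_operator A"
    using A by (auto simp: central_operator_def)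
  have "C x \<le> c *\<^sub>R B x" if "0 \<le> x" for x
  proof -
    have "0 \<le> B (A x)" "0 \<le> B x"
      using posA B that by (auto simp: positive_operator_def)
    then have "C x \<le> A (B x)"
      by (simp add: eq)
    also have "\<dots> \<le> c *\<^sub>R B x"
      using c \<open>0 \<le> B x\<close> by (auto simp: operator_le_def)
    finally show ?thesis .
  qed
  then show ?thesis
    using c by (intro nilpotent_operator_dominated[OF C B(1) _ _ B(2), of c])
      (auto simp: operator_le_def)
qed

text \<open>
  One and the same \<open>B\<close> serves the general and the compact case, which is why compactness appears
  as an implication between \<open>C\<close> and \<open>B\<close>.
\<close>

lemma nilpotent_operator_commutator:
  fixes C :: "'a::banach_lattice \<Rightarrow> 'a"
  assumes pp: "projection_property TYPE('a)"
    and C: "positive_operator C" and oc: "order_continuous C" and nil: "nilpotent_operator C"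
  obtains A B where "central_operator A" "positive_operator B" "order_continuous B"
    "nilpotent_operator B" "compact_operator C \<Longrightarrow> compact_operator B"
    "C = (\<lambda>x. A (B x) - B (A x))"
proof -
  obtain m where m: "0 < m" "C ^^ m = (\<lambda>_. 0)"
    using nil by (auto simp: nilpotent_operator_def)
  have blC: "bounded_linear C"
    using C by (simp add: positive_operator_def)
  then have linC: "linear C"
    by (rule bounded_linear.linear)
  define N where "N k = null_ideal (C ^^ k)" for k
  have posCk: "positive_operator (C ^^ k)" for k
    by (rule positive_operator_funpow[OF C])
  have N: "projection_band (N k)" for k
    using pp band_null_ideal[OF posCk order_continuous_funpow[OF oc]]
    by (simp add: N_def projection_property_def)
  have N_Suc: "N k \<subseteq> N (Suc k)" for k
    using linear_0[OF linC] by (auto simp: N_def null_ideal_def)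
  then have N_mono: "N k \<subseteq> N l" if "k \<le> l" for k l
    using that by (rule lift_Suc_mono_le)
  have N_0: "N 0 = {0}"
    by (auto simp: N_def null_ideal_def)
  have N_m: "N m = UNIV"
    using m by (auto simp: N_def null_ideal_def)
  have CN: "C x \<in> N k" if "x \<in> N (Suc k)" for x k
  proof -
    have "(C ^^ k) \<bar>C x\<bar> \<le> (C ^^ k) (C \<bar>x\<bar>)"
      by (intro positive_operator_mono[OF posCk] positive_operator_abs_le[OF C])
    also have "\<dots> = 0"
      using that by (simp add: N_def null_ideal_def funpow_swap1)
    finally have "(C ^^ k) \<bar>C x\<bar> = 0"
      using posCk[of k] by (intro antisym) (auto simp: positive_operator_def)
    then show ?thesis
      by (simp add: N_def null_ideal_def)
  qed
  define P where "P k = band_projection (N k)" for k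
  have posP: "positive_operator (P k)" for k
    unfolding P_def by (rule positive_operator_band_projection[OF N])
  have PN: "P k x \<in> N k" for k x
    unfolding P_def by (rule band_projection_mem[OF N])
  have P_id: "P l x = x" if "x \<in> N k" "k \<le> l" for k l x
    unfolding P_def using that N_mono by (intro band_projection_id[OF N]) auto
  have PP: "P k (P l x) = P k x" if "k \<le> l" for k l x
    unfolding P_def using that N_mono by (intro band_projection_subset N)
  (* The projection onto the part of N (Suc i) that is disjoint from N i. *)
  define E where "E i x = P (Suc i) x - P i x" for i x
  have blE: "bounded_linear (E i)" for i
    unfolding E_def using posP by (intro bounded_linear_sub) (auto simp: positive_operator_def)
  then have linE: "linear (E i)" for i
    by (rule bounded_linear.linear)
  have posE: "0 \<le> E i x" if "0 \<le> x" for i x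
  proof -
    have "P i (P (Suc i) x) \<le> P (Suc i) x"
      unfolding P_def using that by (intro band_projection_bounds N)
    then show ?thesis
      by (simp add: PP E_def)
  qed
  have E_mem: "E i x \<in> N (Suc i)" for i x
    unfolding E_def using PN N_Suc[of i] projection_bandD(1)[OF N]
    by (intro subspace_diff) auto
  have E_eq_0: "E i x = 0" if "x \<in> N k" "k \<le> i" for i k x
    using that by (simp add: E_def P_id)
  have orth: "E i (E j x) = (if i = j then E i x else 0)" for i j x
  proof (cases i j rule: linorder_cases)
    case less
    then show ?thesis
      using posP by (simp add: E_def PP positive_operator_def bounded_linear.linear linear_diff)
  next
    case equal
    have "P (Suc i) (E i x) = E i x"
      using E_mem by (intro P_id) auto
    moreover have "P i (E i x) = 0"
      using posP by (simp add: E_def PP positive_operator_def bounded_linear.linear linear_diff)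
    ultimately show ?thesis
      using equal E_def[of i "E i x"] by simp
  next
    case greater
    then show ?thesis
      using E_eq_0[OF E_mem[of j x], of i] by simp
  qed
  have total: "(\<Sum>i<m. E i x) = x" for x
  proof -
    have "(\<Sum>i<m. E i x) = P m x - P 0 x"
      unfolding E_def by (rule sum_lessThan_telescope)
    moreover have "P m x = x"
      using N_m by (intro P_id[of _ m]) auto
    moreover have "P 0 x = 0"
      using PN[of 0 x] N_0 by simp
    ultimately show ?thesis
      by simp
  qed
  have upper: "E i (C (E j x)) = 0" if "j \<le> i" for i j x
    using that CN[OF E_mem] by (intro E_eq_0)
  define w :: "nat \<Rightarrow> nat \<Rightarrow> real" where
    "w i j = (if i < j then 1 / (real j - real i) else 0)" for i j
  have w: "0 \<le> w i j" "w i j \<le> 1" for i j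
    by (auto simp: w_def)
  define A where "A x = (\<Sum>i<m. (real m - real i) *\<^sub>R E i x)" for x
  define B where "B x = (\<Sum>i<m. \<Sum>j<m. w i j *\<^sub>R E i (C (E j x)))" for x
  have comm: "C = (\<lambda>x. A (B x) - B (A x))"
    unfolding A_def B_def w_def
    by (rule ext, rule strictly_triangular_commutator[symmetric])
      (auto simp: linC linE orth total upper)
  have "positive_operator A"
    unfolding positive_operator_def A_def
    by (auto intro!: bounded_linear_sum bounded_linear_const_scaleR blE sum_nonneg
        scaleR_nonneg_nonneg posE)
  moreover have "A x \<le> real m *\<^sub>R x" if "0 \<le> x" for x
  proof -
    have "A x \<le> (\<Sum>i<m. real m *\<^sub>R E i x)"
      unfolding A_def using posE that by (intro sum_mono scaleR_right_mono) auto
    also have "\<dots> = real m *\<^sub>R x"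
      by (simp add: total flip: scaleR_sum_right)
    finally show ?thesis .
  qed
  ultimately have cenA: "central_operator A"
    using m by (auto simp: central_operator_def operator_le_def intro!: exI[of _ "real m"])
  have blECE: "bounded_linear (\<lambda>x. E i (C (E j x)))" for i j
    by (intro bounded_linear_compose[OF blE] bounded_linear_compose[OF blC] blE)
  have posECE: "0 \<le> E i (C (E j x))" if "0 \<le> x" for i j x
    using that C by (intro posE) (auto simp: positive_operator_def intro: posE)
  have posB: "positive_operator B"
    unfolding positive_operator_def B_def
    by (auto intro!: bounded_linear_sum bounded_linear_const_scaleR blECE sum_nonneg
        scaleR_nonneg_nonneg posECE w)
  (* All weights are at most 1, and with all weights equal to 1 the blocks add up to C. *)
  have "B x \<le> C x" if "0 \<le> x" for x
  proof -
    have "B x \<le> (\<Sum>i<m. \<Sum>j<m. 1 *\<^sub>R E i (C (E j x)))"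
      unfolding B_def using that by (intro sum_mono scaleR_right_mono w posECE)
    also have "\<dots> = (\<Sum>i<m. E i (C (\<Sum>j<m. E j x)))"
      by (simp add: linear_sum[OF linE] linear_sum[OF linC])
    also have "\<dots> = C x"
      by (simp add: total)
    finally show ?thesis .
  qed
  then have BC: "operator_le B C"
    by (simp add: operator_le_def)
  have "order_continuous B"
    by (rule order_continuous_dominated[OF posB BC oc])
  moreover have "nilpotent_operator B"
    using BC by (intro nilpotent_operator_dominated[OF posB C _ _ nil, of 1]) auto
  moreover have "compact_operator B" if "compact_operator C"
    unfolding B_def using that
    by (intro compact_operator_sum compact_operator_compose_left[OF bounded_linear_scaleR_right]
        compact_operator_compose_left[OF blE] compact_operator_compose_right[OF blE])
  ultimately show thesis
    using that cenA posB comm by blast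
qed

theorem theorem3p1:
  fixes C :: "'a::banach_lattice \<Rightarrow> 'a"
  assumes "projection_property TYPE('a)"
    and "positive_operator C"
    and "order_continuous C"
  shows "(nilpotent_operator C \<longleftrightarrow>
      (\<exists>A B. central_operator A \<and>
        positive_operator B \<and> order_continuous B \<and> nilpotent_operator B \<and>
        C = (\<lambda>x. A (B x) - B (A x))))
    \<and> (compact_operator C \<and> nilpotent_operator C \<longrightarrow>
      (\<exists>A B. central_operator A \<and>
        positive_operator B \<and> order_continuous B \<and> nilpotent_operator B \<and>
        compact_operator B \<and>
        C = (\<lambda>x. A (B x) - B (A x))))"
proof (intro conjI iffI impI)
  assume "nilpotent_operator C"
  then show "\<exists>A B. central_operator A \<and> positive_operator B \<and> order_continuous B \<and>
      nilpotent_operator B \<and> C = (\<lambda>x. A (B x) - B (A x))"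
    by (elim conjE nilpotent_operator_commutator[OF assms]) blast
next
  assume "\<exists>A B. central_operator A \<and> positive_operator B \<and> order_continuous B \<and>
      nilpotent_operator B \<and> C = (\<lambda>x. A (B x) - B (A x))"
  then show "nilpotent_operator C"
    using nilpotent_operator_commutatorD[OF assms(2)] by blast
next
  assume "compact_operator C \<and> nilpotent_operator C"
  then show "\<exists>A B. central_operator A \<and> positive_operator B \<and> order_continuous B \<and>
      nilpotent_operator B \<and> compact_operator B \<and> C = (\<lambda>x. A (B x) - B (A x))"
    by (elim conjE nilpotent_operator_commutator[OF assms]) blast
qed

end
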